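(* Let $0\le a<b$ be real numbers and let $\alpha>0$. Let $f:[a,b]\to\mathbb{R}$ be a convex function with $f\in L[a,b]$. Let $g:[a,b]\to\mathbb{R}$ be nonnegative, integrable and symmetric to $(a+b)/2$. Then $$f\left(\frac{a+b}{2}\right)\left[J_{a+}^{\alpha}g(b)+J_{b-}^{\alpha}g(a)\right]\le \left[J_{a+}^{\alpha}(fg)(b)+J_{b-}^{\alpha}(fg)(a)\right]\le \frac{f(a)+f(b)}{2}\left[J_{a+}^{\alpha}g(b)+J_{b-}^{\alpha}g(a)\right].$$
   Context: $L[a,b]$ denotes the space of Lebesgue integrable functions on $[a,b]$. For $h\in L[a,b]$ and $\alpha>0$, the Riemann-Liouville fractional integrals of order $\alpha$ are $$J_{a+}^{\alpha}h(x)=\frac{1}{\Gamma(\alpha)}\int_a^x (x-t)^{\alpha-1}h(t)\,dt\quad (x>a),\qquad J_{b-}^{\alpha}h(x)=\frac{1}{\Gamma(\alpha)}\int_x^b (t-x)^{\alpha-1}h(t)\,dt\quad (x<b),$$ where $\Gamma(\alpha)=\int_0^\infty e^{-t}t^{\alpha-1}\,dt$. In particular $J_{a+}^{\alpha}h(b)=\frac{1}{\Gamma(\alpha)}\int_a^b (b-t)^{\alpha-1}h(t)\,dt$ and $J_{b-}^{\alpha}h(a)=\frac{1}{\Gamma(\alpha)}\int_a^b (t-a)^{\alpha-1}h(t)\,dt$. The fractional integrals of $g$ appearing in the statement are understood to exist as finite Lebesgue integrals, i.e. $t\mapsto (b-t)^{\alpha-1}g(t)$ and $t\mapsto (t-a)^{\alpha-1}g(t)$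 are integrable on $[a,b]$ (this is automatic if $\alpha\ge 1$). "$g$ is symmetric to $(a+b)/2$" means $g(a+b-x)=g(x)$ for all $x\in[a,b]$. $fg$ denotes the pointwise product. *)

theory Defs
  imports "HOL-Analysis.Analysis"
begin

(* Riemann-Liouville fractional integrals of order alpha > 0, as Lebesgue integrals.
   The measure is lebesgue, so h need not be Borel measurable. At t = x the kernel takes
   the value 0 powr (alpha - 1) = 0, also for alpha = 1; this is immaterial on a null set.
   The value is meaningful only if the integrand is Lebesgue integrable; otherwise the
   integral is 0 by convention. *)

definition rl_integral_left :: "real \<Rightarrow> real \<Rightarrow> (real \<Rightarrow> real) \<Rightarrow> real \<Rightarrow> real" where
  "rl_integral_left \<alpha> a h x =
     1 / Gamma \<alpha> * (LINT t:{a..x}|lebesgue. (x - t) powr (\<alpha> - 1) * h t)"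

definition rl_integral_right :: "real \<Rightarrow> real \<Rightarrow> (real \<Rightarrow> real) \<Rightarrow> real \<Rightarrow> real" where
  "rl_integral_right \<alpha> b h x =
     1 / Gamma \<alpha> * (LINT t:{x..b}|lebesgue. (t - x) powr (\<alpha> - 1) * h t)"

end

theory Submission
  imports Defs
begin

text \<open>
  The reflection t \<mapsto> a + b - t interchanges the kernels of the left and the right fractional
  integral and fixes g. Hence, for the weight w(t) = (b - t) powr (\<alpha> - 1) * g t, the middle term is a
  multiple of the integral of (f(t) + f(a + b - t)) w(t), and convexity bounds
  f(t) + f(a + b - t) between 2 f((a + b) / 2) and f(a) + f(b).
\<close>

text \<open>The substitution has slope -1 and maps the interval onto itself. The affine change of
  variables needs no integrability of \<open>h\<close>, so none is assumed.\<close>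

lemma set_lebesgue_integral_reflect_Icc:
  fixes h :: "real \<Rightarrow> real"
  shows "(LINT t:{a..b}|lebesgue. h (a + b - t)) = (LINT t:{a..b}|lebesgue. h t)"
proof -
  have "indicator {a..b} (a + b - t) = (indicator {a..b} t :: real)" for t
    by (auto simp: indicator_def)
  then show ?thesis
    unfolding set_lebesgue_integral_def
    using lebesgue_integral_real_affine[of "-1" "\<lambda>t. indicator {a..b} t *\<^sub>R h t" "a + b"] by simp
qed

lemma set_integrable_lebesgue_reflect_Icc:
  fixes h :: "real \<Rightarrow> real"
  assumes "set_integrable lebesgue {a..b} h"
  shows "set_integrable lebesgue {a..b} (\<lambda>t. h (a + b - t))"
proof -
  have "indicator {a..b} (a + b - t) = (indicator {a..b} t :: real)" for t
    by (auto simp: indicator_def)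
  then show ?thesis
    using assms unfolding set_integrable_def
    using lebesgue_integrable_real_affine_iff[of "-1" "\<lambda>t. indicator {a..b} t *\<^sub>R h t" "a + b"] by simp
qed

lemma convex_on_reflect_bounds:
  fixes f :: "real \<Rightarrow> real"
  assumes "convex_on {a..b} f" and "t \<in> {a..b}"
  shows "2 * f ((a + b) / 2) \<le> f t + f (a + b - t)"
    and "f t + f (a + b - t) \<le> f a + f b"
proof -
  have mid: "(a + b) / 2 = (1 - 1/2) *\<^sub>R t + (1/2) *\<^sub>R (a + b - t)"
    by (simp add: field_simps)
  have "f ((a + b) / 2) \<le> (1 - 1/2) * f t + 1/2 * f (a + b - t)"
    unfolding mid using assms by (intro convex_onD) auto
  then show "2 * f ((a + b) / 2) \<le> f t + f (a + b - t)"
    by simp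
  have "a + b - t \<in> {a..b}" using assms by auto
  \<comment> \<open>The chord bound for \<open>t\<close> is anchored at \<open>a\<close>, the one
    for \<open>a + b - t\<close> at \<open>b\<close>. Both points lie at distance
    \<open>t - a\<close> from their anchors and the two slopes are opposite, so the linear terms
    cancel in the sum.\<close>
  from convex_onD_Icc'[OF assms] convex_onD_Icc''[OF assms(1) this]
  show "f t + f (a + b - t) \<le> f a + f b"
    by (simp add: diff_divide_distrib left_diff_distrib)
qed

lemma convex_on_Icc_bounded:
  fixes f :: "real \<Rightarrow> real"
  assumes "convex_on {a..b} f"
  shows "bounded (f ` {a..b})"
proof -
  define M where "M = max (f a) (f b)"
  have upper: "f t \<le> M" if "t \<in> {a..b}" for t
    using convex_on_le_max[OF assms that] by (simp add: M_def)
  have "\<bar>f t\<bar> \<le> \<bar>M\<bar> + \<bar>2 * f ((a + b) / 2) - M\<bar>" if "t \<in> {a..b}" for t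
  proof -
    have "a + b - t \<in> {a..b}" using that by auto
    then show ?thesis
      using upper[OF that] upper[of "a + b - t"] convex_on_reflect_bounds(1)[OF assms that] by linarith
  qed
  then show ?thesis
    by (intro boundedI[where B = "\<bar>M\<bar> + \<bar>2 * f ((a + b) / 2) - M\<bar>"]) auto
qed

text \<open>A Fejer-type inequality for a weight that may be asymmetric: pairing \<open>w\<close>
  with its reflection in \<open>I\<close> takes the place of symmetry. This suits the kernel (b - t)
  powr (\<alpha> - 1), which is not symmetric even though g is.\<close>

lemma convex_weighted_Hermite_Hadamard:
  fixes f w :: "real \<Rightarrow> real"
  assumes f: "convex_on {a..b} f" "set_integrable lebesgue {a..b} f"
    and w: "set_integrable lebesgue {a..b} w" "\<And>t. t \<in> {a..b} \<Longrightarrow> 0 \<le> w t"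
  defines "I \<equiv> (LINT t:{a..b}|lebesgue. f t * w t) + (LINT t:{a..b}|lebesgue. f t * w (a + b - t))"
  shows "2 * f ((a + b) / 2) * (LINT t:{a..b}|lebesgue. w t) \<le> I"
    and "I \<le> (f a + f b) * (LINT t:{a..b}|lebesgue. w t)"
proof -
  \<comment> \<open>f is bounded by convexity and measurable by integrability, so multiplying by it
    preserves integrability.\<close>
  have prod: "set_integrable lebesgue {a..b} (\<lambda>t. f t * v t)"
    if "set_integrable lebesgue {a..b} v" for v
    using f that
    by (intro absolutely_integrable_bounded_measurable_product_real convex_on_Icc_bounded
        absolutely_integrable_measurable[THEN iffD1, THEN conjunct1]) auto
  have fw: "set_integrable lebesgue {a..b} (\<lambda>t. f t * w t)"
    by (rule prod[OF w(1)])
  \<comment> \<open>Reflect \<open>w\<close>, multiply by f, and reflect back: the reflection ends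
    up on f.\<close>
  have rfw: "set_integrable lebesgue {a..b} (\<lambda>t. f (a + b - t) * w t)"
    using set_integrable_lebesgue_reflect_Icc[OF prod[OF set_integrable_lebesgue_reflect_Icc[OF w(1)]]]
    by simp
  have "(LINT t:{a..b}|lebesgue. f t * w (a + b - t)) = (LINT t:{a..b}|lebesgue. f (a + b - t) * w t)"
    using set_lebesgue_integral_reflect_Icc[of a b "\<lambda>t. f (a + b - t) * w t"] by simp
  then have I: "I = (LINT t:{a..b}|lebesgue. (f t + f (a + b - t)) * w t)"
    unfolding I_def using set_integral_add(2)[OF fw rfw] by (simp add: distrib_right)
  have int: "set_integrable lebesgue {a..b} (\<lambda>t. (f t + f (a + b - t)) * w t)"
    using set_integral_add(1)[OF fw rfw] by (simp add: distrib_right)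
  have "(LINT t:{a..b}|lebesgue. 2 * f ((a + b) / 2) * w t) \<le> I"
    unfolding I using w convex_on_reflect_bounds(1)[OF f(1)]
    by (intro set_integral_mono int set_integrable_mult_right mult_right_mono) auto
  then show "2 * f ((a + b) / 2) * (LINT t:{a..b}|lebesgue. w t) \<le> I"
    by simp
  have "I \<le> (LINT t:{a..b}|lebesgue. (f a + f b) * w t)"
    unfolding I using w convex_on_reflect_bounds(2)[OF f(1)]
    by (intro set_integral_mono int set_integrable_mult_right mult_right_mono) auto
  then show "I \<le> (f a + f b) * (LINT t:{a..b}|lebesgue. w t)"
    by simp
qed

theorem theorem4:
  fixes a b \<alpha> :: real and f g :: "real \<Rightarrow> real"
  assumes "0 \<le> a" and "a < b" and "\<alpha> > 0"
    and "convex_on {a..b} f"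
    and "set_integrable lebesgue {a..b} f"
    and "\<And>x. x \<in> {a..b} \<Longrightarrow> g x \<ge> 0"
    and "set_integrable lebesgue {a..b} g"
    and "\<And>x. x \<in> {a..b} \<Longrightarrow> g (a + b - x) = g x"
    and "set_integrable lebesgue {a..b} (\<lambda>t. (b - t) powr (\<alpha> - 1) * g t)"
    and "set_integrable lebesgue {a..b} (\<lambda>t. (t - a) powr (\<alpha> - 1) * g t)"
  shows "f ((a + b) / 2) * (rl_integral_left \<alpha> a g b + rl_integral_right \<alpha> b g a)
           \<le> rl_integral_left \<alpha> a (\<lambda>t. f t * g t) b + rl_integral_right \<alpha> b (\<lambda>t. f t * g t) a
       \<and> rl_integral_left \<alpha> a (\<lambda>t. f t * g t) b + rl_integral_right \<alpha> b (\<lambda>t. f t * g t) a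
           \<le> (f a + f b) / 2 * (rl_integral_left \<alpha> a g b + rl_integral_right \<alpha> b g a)"
proof -
  define c where "c = 1 / Gamma \<alpha>"
  define w where "w = (\<lambda>t. (b - t) powr (\<alpha> - 1) * g t)"
  define W where "W = (LINT t:{a..b}|lebesgue. w t)"
  \<comment> \<open>Reflection turns b - t into t - a, and symmetry of g removes the reflection from
    g. Symmetry is known only on the interval, so the integrals below are compared by congruence on
    that set.\<close>
  have refl: "w (a + b - t) = (t - a) powr (\<alpha> - 1) * g t" if "t \<in> {a..b}" for t
    using assms(8)[OF that] by (simp add: w_def)
  have Jg_left: "rl_integral_left \<alpha> a g b = c * W"
    by (simp add: rl_integral_left_def c_def W_def w_def)
  have "(LINT t:{a..b}|lebesgue. (t - a) powr (\<alpha> - 1) * g t) = (LINT t:{a..b}|lebesgue. w (a + b - t))"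
    using refl by (intro set_lebesgue_integral_cong) auto
  then have Jg_right: "rl_integral_right \<alpha> b g a = c * W"
    by (simp add: rl_integral_right_def c_def set_lebesgue_integral_reflect_Icc W_def)
  have Jfg_left: "rl_integral_left \<alpha> a (\<lambda>t. f t * g t) b
      = c * (LINT t:{a..b}|lebesgue. f t * w t)"
    by (simp add: rl_integral_left_def c_def w_def mult_ac)
  have "(LINT t:{a..b}|lebesgue. (t - a) powr (\<alpha> - 1) * (f t * g t))
      = (LINT t:{a..b}|lebesgue. f t * w (a + b - t))"
    using refl by (intro set_lebesgue_integral_cong) auto
  then have Jfg_right: "rl_integral_right \<alpha> b (\<lambda>t. f t * g t) a
      = c * (LINT t:{a..b}|lebesgue. f t * w (a + b - t))"
    by (simp add: rl_integral_right_def c_def)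
  have w: "set_integrable lebesgue {a..b} w" "\<And>t. t \<in> {a..b} \<Longrightarrow> 0 \<le> w t"
    using assms(6,9) by (auto simp: w_def)
  \<comment> \<open>Both fractional integrals of g equal \<open>c * W\<close>, so their sum is 2 c
    W. This accounts for the factor 2 in the lower bound and cancels the 1/2 in the upper
    one.\<close>
  note HH = convex_weighted_Hermite_Hadamard[OF assms(4,5) w, folded W_def]
  have pos: "0 \<le> c"
    using Gamma_real_pos[OF assms(3)] by (simp add: c_def)
  show ?thesis
    using mult_left_mono[OF HH(1) pos] mult_left_mono[OF HH(2) pos]
    unfolding Jg_left Jg_right Jfg_left Jfg_right by (simp add: algebra_simps)
qed

end
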